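(* Let $G$ be an edge-colored graph on $n$ vertices. If $d^{c}(v)\geq (n+1)/2$ for every vertex $v\in V(G)$, then $G$ contains a rainbow triangle.
   Context: All graphs are simple and finite, with at least one vertex. An edge-colored graph is a graph $G=(V,E)$ together with an arbitrary mapping $C:E\to\mathbb{N}$ (not required to be a proper edge-coloring). For a vertex $v$ of $G$, the color degree $d^c(v)$ is the number of distinct colors appearing on the edges incident to $v$. A rainbow triangle is a triangle of $G$ whose three edges have pairwise distinct colors. *)

theory Defs
  imports Complex_Main "HOL-Library.Ramsey"
begin

(* An undirected edge joining u and v is the two-element set {u, v}, and nsets V 2
   is the set of all two-element subsets of V.  This rules out loops and parallel edges. *)
locale simple_graph =
  fixes V :: "'a set" and E :: "'a set set"
  assumes finite_vertices: "finite V"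
    and vertices_nonempty: "V \<noteq> {}"
    and edges: "E \<subseteq> nsets V 2"

(* Colorings are total functions on 'a set; only their values on E are used. *)
definition color_degree :: "'a set set \<Rightarrow> ('a set \<Rightarrow> nat) \<Rightarrow> 'a \<Rightarrow> nat" where
  "color_degree E C v = card (C ` {e \<in> E. v \<in> e})"

definition triangle :: "'a set set \<Rightarrow> 'a \<Rightarrow> 'a \<Rightarrow> 'a \<Rightarrow> bool" where
  "triangle E x y z \<longleftrightarrow>
     distinct [x, y, z] \<and> {x, y} \<in> E \<and> {y, z} \<in> E \<and> {x, z} \<in> E"

definition rainbow_triangle :: "'a set set \<Rightarrow> ('a set \<Rightarrow> nat) \<Rightarrow> 'a \<Rightarrow> 'a \<Rightarrow> 'a \<Rightarrow> bool" where
  "rainbow_triangle E C x y z \<longleftrightarrow>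
     triangle E x y z \<and> distinct [C {x, y}, C {y, z}, C {x, z}]"

end

theory Submission
  imports Defs
begin

text \<open>
  Li, Ning, Xu and Zhang: if there is no rainbow triangle, then \<open>2 (e + c) < n (n + 1)\<close>, where \<open>e\<close> and
  \<open>c\<close> count edges and colors. Call a color saturated at \<open>v\<close> if all its edges contain \<open>v\<close>. Deleting
  \<open>v\<close> loses \<open>deg v\<close> edges and the colors saturated at \<open>v\<close>, so by induction it is enough to find
  \<open>v\<close> where these two numbers add up to at most \<open>n\<close>. Otherwise, let \<open>v\<close> have the maximal number \<open>s\<close>
  of saturated colors; picking one neighbor for each of them gives an independent set of size \<open>s\<close>,
  whose members have degree at most \<open>n - s\<close> and hence more than \<open>s\<close> saturated colors.

  For color degrees, remove edges while all color degrees are preserved. In the end every color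
  class is a disjoint union of stars. Giving each star its own color creates no rainbow triangle,
  and a star with \<open>k\<close> edges contributes \<open>k + 1\<close> to the sum of the color degrees, so this
  sum is at most \<open>e + c\<close>.
\<close>

text \<open>These are the colors that disappear when \<open>v\<close> is deleted. The color type is
  arbitrary because stars, which are sets of edges, serve as colors later.\<close>

definition saturated :: "'a set set \<Rightarrow> ('a set \<Rightarrow> 'b) \<Rightarrow> 'a \<Rightarrow> 'b set" where
  "saturated E C v = C ` E - C ` {e \<in> E. v \<notin> e}"

lemma nsets_2_other_end:
  assumes "e \<in> nsets V 2" "v \<in> e"
  obtains w where "w \<in> V" "w \<noteq> v" "e = {v, w}"
proof -
  obtain x y where "e = {x, y}" "x \<noteq> y" "x \<in> V" "y \<in> V"
    using assms(1) by (auto simp: nsets_2_eq)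
  then show ?thesis using assms(2) that by (cases "v = x") (auto simp: insert_commute)
qed

lemma finite_nsets_subset:
  assumes "finite V" "E \<subseteq> nsets V k"
  shows "finite E"
  using assms finite_imp_finite_nsets finite_subset by metis

lemma card_incident_le:
  assumes "finite V" "E \<subseteq> nsets V 2" "\<And>w. {v, w} \<in> E \<Longrightarrow> w \<noteq> v \<Longrightarrow> w \<notin> T"
  shows "card {e \<in> E. v \<in> e} \<le> card (V - T - {v})"
proof -
  have "{e \<in> E. v \<in> e} \<subseteq> (\<lambda>w. {v, w}) ` (V - T - {v})"
  proof
    fix e assume e: "e \<in> {e \<in> E. v \<in> e}"
    then obtain w where "w \<in> V" "w \<noteq> v" "e = {v, w}"
      using assms(2) by (auto elim: nsets_2_other_end[of e V v])
    then show "e \<in> (\<lambda>w. {v, w}) ` (V - T - {v})" using e assms(3) by auto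
  qed
  then show ?thesis using assms(1) by (meson finite_Diff surj_card_le)
qed

lemma saturated_edge:
  assumes "c \<in> saturated E C v"
  shows "\<exists>e\<in>E. C e = c \<and> v \<in> e"
  using assms unfolding saturated_def by auto

lemma saturated_mem:
  assumes "C e \<in> saturated E C v" "e \<in> E"
  shows "v \<in> e"
  using assms unfolding saturated_def by auto

lemma ex_degree_plus_saturated_le:
  assumes fin: "finite V" and ne: "V \<noteq> {}" and E: "E \<subseteq> nsets V 2"
    and no: "\<And>x y z. triangle E x y z \<Longrightarrow> \<not> distinct [C {x, y}, C {y, z}, C {x, z}]"
  shows "\<exists>v\<in>V. card {e \<in> E. v \<in> e} + card (saturated E C v) \<le> card V"
proof (rule ccontr)
  assume "\<not> ?thesis"
  then have big: "card V < card {e \<in> E. v \<in> e} + card (saturated E C v)" if "v \<in> V" for v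
    using that by (meson not_le)
  let ?s = "\<lambda>v. card (saturated E C v)"
  have "Max (?s ` V) \<in> ?s ` V" using fin ne by simp
  then obtain v where v: "v \<in> V" and "?s v = Max (?s ` V)" by auto
  then have mx: "?s w \<le> ?s v" if "w \<in> V" for w using that fin by simp
  have "\<exists>w. w \<in> V \<and> w \<noteq> v \<and> {v, w} \<in> E \<and> C {v, w} = c" if c: "c \<in> saturated E C v" for c
  proof -
    obtain e where e: "e \<in> E" "C e = c" "v \<in> e" using saturated_edge[OF c] by auto
    then have "e \<in> nsets V 2" using E by auto
    from nsets_2_other_end[OF this e(3)] show ?thesis using e by metis
  qed
  then obtain h where h: "\<And>c. c \<in> saturated E C v \<Longrightarrow>
      h c \<in> V \<and> h c \<noteq> v \<and> {v, h c} \<in> E \<and> C {v, h c} = c" by metis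
  define T where "T = h ` saturated E C v"
  have "inj_on h (saturated E C v)" using h by (metis inj_onI)
  then have cardT: "card T = ?s v" unfolding T_def by (rule card_image)
  have TV: "T \<subseteq> V" using h unfolding T_def by auto
  \<comment> \<open>The triangle \<open>v\<close>, \<open>x\<close>, \<open>y\<close> is not rainbow
    and its edges at \<open>v\<close> have different colors, so \<open>{x, y}\<close> repeats one of
    them. That color is saturated at \<open>v\<close>, which would put \<open>v\<close> on
    \<open>{x, y}\<close>.\<close>
  have indep: "y \<notin> T" if x: "x \<in> T" and xy: "{x, y} \<in> E" "y \<noteq> x" for x y
  proof
    assume "y \<in> T"
    then obtain a b where a: "a \<in> saturated E C v" "x = h a" and b: "b \<in> saturated E C v" "y = h b"
      using x unfolding T_def by auto
    have "triangle E v x y" using h[OF a(1)] h[OF b(1)] xy a(2) b(2) unfolding triangle_def by auto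
    moreover have "C {v, x} = a" "C {v, y} = b" "a \<noteq> b" "v \<noteq> x" "v \<noteq> y"
      using h[OF a(1)] h[OF b(1)] a(2) b(2) xy by auto
    ultimately have "C {x, y} = a \<or> C {x, y} = b" using no[of v x y] by auto
    then have "v \<in> {x, y}" using saturated_mem xy(1) a(1) b(1) by metis
    then show False using \<open>v \<noteq> x\<close> \<open>v \<noteq> y\<close> by simp
  qed
  \<comment> \<open>The trivial bound on the degree of \<open>v\<close> already forces a saturated
    color, so \<open>T\<close> is nonempty.\<close>
  have "card {e \<in> E. v \<in> e} \<le> card (V - {} - {v})" using fin E by (intro card_incident_le) auto
  also have "\<dots> \<le> card V" using fin by (simp add: card_mono)
  finally have "?s v \<noteq> 0" using big[OF v] by simp
  then obtain x where x: "x \<in> T" using cardT by (metis card.empty ex_in_conv)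
  then have xV: "x \<in> V" using TV by auto
  have "card {e \<in> E. x \<in> e} \<le> card (V - T - {x})"
    using fin E indep[OF x] by (intro card_incident_le) auto
  \<comment> \<open>Since \<open>x\<close> lies in \<open>T\<close>, removing it again changes
    nothing.\<close>
  also have "\<dots> = card V - ?s v"
    using x fin TV cardT by (simp add: card_Diff_subset finite_subset)
  finally have "card {e \<in> E. x \<in> e} + ?s v \<le> card V"
    using cardT TV fin by (metis card_mono le_diff_conv2)
  then show False using big[OF xV] mx[OF xV] by simp
qed

lemma edges_plus_colors_less:
  assumes "finite V" "V \<noteq> {}" "E \<subseteq> nsets V 2"
    and "\<And>x y z. triangle E x y z \<Longrightarrow> \<not> distinct [C {x, y}, C {y, z}, C {x, z}]"
  shows "2 * (card E + card (C ` E)) < card V * (card V + 1)"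
  using assms
proof (induction "card V" arbitrary: V E rule: less_induct)
  case less
  note fin = less.prems(1) and E = less.prems(3)
  obtain v where v: "v \<in> V" and dv: "card {e \<in> E. v \<in> e} + card (saturated E C v) \<le> card V"
    using ex_degree_plus_saturated_le[of V E C] less.prems by blast
  have finE: "finite E" using fin E by (rule finite_nsets_subset)
  let ?V = "V - {v}" and ?E = "{e \<in> E. v \<notin> e}"
  show ?case
  \<comment> \<open>The induction hypothesis needs a remaining vertex. On a single vertex the bound
    reads 0 < 2, the source of the strict inequality.\<close>
  proof (cases "?V = {}")
    case True
    then have "V = {v}" using v by auto
    then have "E = {}" using E by (auto simp: nsets_2_eq)
    then show ?thesis using v fin by (auto simp: card_gt_0_iff)
  next
    case False
    have cV: "card V = Suc (card ?V)" using v fin by (metis card_Suc_Diff1)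
    have "2 * (card ?E + card (C ` ?E)) < card ?V * (card ?V + 1)"
    proof (rule less.hyps)
      show "card ?V < card V" using cV by simp
      show "?E \<subseteq> nsets ?V 2" using E by (auto simp: nsets_def)
      show "\<not> distinct [C {x, y}, C {y, z}, C {x, z}]" if "triangle ?E x y z" for x y z
        using that less.prems(4)[of x y z] by (auto simp: triangle_def)
    qed (use fin False in auto)
    moreover have "card E = card {e \<in> E. v \<in> e} + card ?E"
      using finE by (subst card_Un_disjoint[symmetric]) (auto intro: arg_cong[of _ _ card])
    moreover have "card (C ` E) = card (saturated E C v) + card (C ` ?E)"
      unfolding saturated_def using finE
      by (subst card_Un_disjoint[symmetric]) (auto intro: arg_cong[of _ _ card])
    \<comment> \<open>Edges and colors together drop by at most n, and n (n + 1) - (n - 1) n = 2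
      n.\<close>
    ultimately show ?thesis using dv cV by (simp add: algebra_simps)
  qed
qed

text \<open>The witness \<open>u\<close> is an end of \<open>e\<close> that is a leaf in the color
  class of \<open>e\<close>. Such an end on every edge rules out monochromatic triangles and
  three-edge paths, which leaves disjoint stars.\<close>

definition star_forest_coloring :: "'a set set \<Rightarrow> ('a set \<Rightarrow> 'b) \<Rightarrow> bool" where
  "star_forest_coloring E C \<longleftrightarrow>
     (\<forall>e\<in>E. \<exists>u\<in>e. \<forall>f\<in>E. u \<in> f \<longrightarrow> C f = C e \<longrightarrow> f = e)"

text \<open>In a smallest subgraph with the same color degrees, an edge that met another edge of its
  color at both ends could still be deleted.\<close>

lemma ex_star_forest_subgraph:
  assumes "finite E"
  obtains F where "F \<subseteq> E" "star_forest_coloring F C" "color_degree F C = color_degree E C"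
proof -
  let ?P = "\<lambda>F. F \<subseteq> E \<and> color_degree F C = color_degree E C"
  obtain F where F: "?P F" and min: "\<And>F'. ?P F' \<Longrightarrow> card F \<le> card F'"
    using ex_has_least_nat[of ?P E card] by auto
  have "star_forest_coloring F C"
    unfolding star_forest_coloring_def
  proof (rule ballI, rule ccontr)
    fix e assume e: "e \<in> F"
      and "\<not> (\<exists>u\<in>e. \<forall>f\<in>F. u \<in> f \<longrightarrow> C f = C e \<longrightarrow> f = e)"
    then have repl: "\<exists>f\<in>F. u \<in> f \<and> C f = C e \<and> f \<noteq> e" if "u \<in> e" for u
      using that by auto
    have "C ` {f \<in> F - {e}. u \<in> f} = C ` {f \<in> F. u \<in> f}" for u
    proof
      show "C ` {f \<in> F. u \<in> f} \<subseteq> C ` {f \<in> F - {e}. u \<in> f}"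
      proof
        fix c assume "c \<in> C ` {f \<in> F. u \<in> f}"
        then obtain f where f: "f \<in> F" "u \<in> f" "c = C f" by auto
        then obtain g where "g \<in> F - {e}" "u \<in> g" "C g = c"
          using repl[of u] by (cases "f = e") auto
        then show "c \<in> C ` {f \<in> F - {e}. u \<in> f}" by auto
      qed
    qed auto
    then have "color_degree (F - {e}) C = color_degree F C"
      unfolding color_degree_def by (intro ext) (simp only:)
    then have "card F \<le> card (F - {e})" using F min[of "F - {e}"] by auto
    moreover have "card (F - {e}) < card F"
      using e F assms by (meson card_Diff1_less finite_subset)
    ultimately show False by simp
  qed
  then show ?thesis using F that by blast
qed

text \<open>In a star forest coloring, two edges of a color lie in the same star exactly if they meet.\<close>

definition star :: "'a set set \<Rightarrow> ('a set \<Rightarrow> 'b) \<Rightarrow> 'a set \<Rightarrow> 'a set set" where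
  "star E C e = {f \<in> E. C f = C e \<and> f \<inter> e \<noteq> {}}"

text \<open>One end \<open>u\<close> of the middle edge \<open>f\<close> is a leaf in its color, so
  \<open>e\<close> and \<open>g\<close>, unless equal to \<open>f\<close>, can meet \<open>f\<close>
  only in the other end \<open>w\<close>.\<close>

lemma star_forest_meet_trans:
  assumes E: "E \<subseteq> nsets V 2" and S: "star_forest_coloring E C"
    and efg: "e \<in> E" "f \<in> E" "g \<in> E"
    and c: "C e = C f" "C g = C f"
    and ef: "e \<inter> f \<noteq> {}" and fg: "f \<inter> g \<noteq> {}"
  shows "e \<inter> g \<noteq> {}"
proof -
  obtain u where u: "u \<in> f" "\<And>h. h \<in> E \<Longrightarrow> u \<in> h \<Longrightarrow> C h = C f \<Longrightarrow> h = f"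
    using S efg(2) unfolding star_forest_coloring_def by metis
  obtain w where w: "f = {u, w}"
    using efg(2) u(1) E by (auto elim: nsets_2_other_end[of f V u])
  have "e = f \<or> w \<in> e" "g = f \<or> w \<in> g"
    using u(2)[of e] u(2)[of g] efg c ef fg w by auto
  then show ?thesis using w ef fg by auto
qed

text \<open>Meeting is transitive within a color, so stars are equivalence classes and partition
  \<open>E\<close>.\<close>

lemma star_eq:
  assumes E: "E \<subseteq> nsets V 2" and S: "star_forest_coloring E C"
    and e: "e \<in> E" and f: "f \<in> star E C e"
  shows "star E C f = star E C e"
proof -
  have f': "f \<in> E" "C f = C e" "f \<inter> e \<noteq> {}" using f unfolding star_def by auto
  have "g \<inter> f \<noteq> {} \<longleftrightarrow> g \<inter> e \<noteq> {}" if "g \<in> E" "C g = C e" for g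
    using star_forest_meet_trans[OF E S \<open>g \<in> E\<close> f'(1) e] star_forest_meet_trans[OF E S \<open>g \<in> E\<close> e f'(1)]
      that f' by (metis inf_commute)
  then show ?thesis unfolding star_def using f'(2) by auto
qed

lemma star_self:
  assumes "E \<subseteq> nsets V 2" "e \<in> E"
  shows "e \<in> star E C e"
  using assms unfolding star_def nsets_def by force

text \<open>The edge \<open>e\<close> covers two vertices, and each further edge meets
  \<open>e\<close> and so adds at most one.\<close>

lemma card_Union_star_le:
  assumes fin: "finite E" and E: "E \<subseteq> nsets V 2" and e: "e \<in> E"
  shows "card (\<Union> (star E C e)) \<le> card (star E C e) + 1"
proof -
  let ?K = "star E C e"
  have K: "?K \<subseteq> E" "finite ?K" using fin unfolding star_def by auto
  have edge: "finite f \<and> card f = 2" if "f \<in> E" for f using that E by (auto simp: nsets_def)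
  have eK: "e \<in> ?K" using E e by (rule star_self)
  have one: "card (f - e) \<le> 1" if "f \<in> ?K" for f
  proof -
    have "f \<in> E" "f \<inter> e \<noteq> {}" using that unfolding star_def by auto
    then have "card (f \<inter> e) \<ge> 1" using edge[of f] by (simp add: Suc_leI card_gt_0_iff)
    then show ?thesis using edge[OF \<open>f \<in> E\<close>] by (simp add: card_Diff_subset_Int)
  qed
  have "\<Union> ?K = e \<union> (\<Union>f\<in>?K - {e}. f - e)" using eK by auto
  then have "card (\<Union> ?K) \<le> card e + card (\<Union>f\<in>?K - {e}. f - e)" by (metis card_Un_le)
  also have "card (\<Union>f\<in>?K - {e}. f - e) \<le> (\<Sum>f\<in>?K - {e}. card (f - e))"
    using K by (intro card_UN_le) auto
  also have "\<dots> \<le> (\<Sum>f\<in>?K - {e}. 1)" by (intro sum_mono one) auto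
  also have "\<dots> = card ?K - 1" using eK by simp
  finally have "card (\<Union> ?K) \<le> card e + (card ?K - 1)" by simp
  moreover have "card ?K \<ge> 1" using eK K by (metis One_nat_def Suc_leI card_gt_0_iff empty_iff)
  ultimately show ?thesis using edge[OF e] by simp
qed

text \<open>Count the pairs of a vertex and a star covering it in two ways.\<close>

lemma sum_color_degree_le:
  assumes fin: "finite V" and E: "E \<subseteq> nsets V 2" and S: "star_forest_coloring E C"
  shows "(\<Sum>v\<in>V. color_degree E C v) \<le> card E + card (star E C ` E)"
proof -
  let ?\<K> = "star E C ` E"
  have finE: "finite E" using fin E by (rule finite_nsets_subset)
  have K: "K \<subseteq> E" "finite K" if "K \<in> ?\<K>" for K
    using that finE unfolding star_def by auto
  have V: "\<Union> K \<subseteq> V" if "K \<in> ?\<K>" for K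
    using K[OF that] E by (auto simp: nsets_def)
  have deg: "color_degree E C v \<le> card {K \<in> ?\<K>. v \<in> \<Union> K}" for v
    unfolding color_degree_def
  proof (rule surj_card_le)
    \<comment> \<open>Color is constant on a star, so any representative gives it. This maps the
      stars at \<open>v\<close> onto the colors at \<open>v\<close>.\<close>
    show "C ` {e \<in> E. v \<in> e} \<subseteq> (\<lambda>K. C (SOME f. f \<in> K)) ` {K \<in> ?\<K>. v \<in> \<Union> K}"
    proof
      fix c assume "c \<in> C ` {e \<in> E. v \<in> e}"
      then obtain e where e: "e \<in> E" "v \<in> e" "c = C e" by auto
      have self: "e \<in> star E C e" using E e(1) by (rule star_self)
      then have "(SOME f. f \<in> star E C e) \<in> star E C e" by (rule someI)
      then have "C (SOME f. f \<in> star E C e) = c" using e unfolding star_def by auto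
      then show "c \<in> (\<lambda>K. C (SOME f. f \<in> K)) ` {K \<in> ?\<K>. v \<in> \<Union> K}"
        using e self by (intro image_eqI[of _ _ "star E C e"]) auto
    qed
  qed (use finE in simp)
  have disj: "K \<inter> L = {}" if "K \<in> ?\<K>" "L \<in> ?\<K>" "K \<noteq> L" for K L
    using that star_eq[OF E S] by blast
  have "(\<Sum>v\<in>V. color_degree E C v) \<le> (\<Sum>v\<in>V. card {K \<in> ?\<K>. v \<in> \<Union> K})"
    by (intro sum_mono deg)
  also have "\<dots> = (\<Sum>K\<in>?\<K>. card {v \<in> V. v \<in> \<Union> K})"
    using fin finE by (intro sum_multicount_gen[symmetric]) auto
  also have "\<dots> \<le> (\<Sum>K\<in>?\<K>. card K + 1)"
  proof (rule sum_mono)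
    fix K assume "K \<in> ?\<K>"
    then have "{v \<in> V. v \<in> \<Union> K} = \<Union> K" using V by blast
    then show "card {v \<in> V. v \<in> \<Union> K} \<le> card K + 1"
      using \<open>K \<in> ?\<K>\<close> card_Union_star_le[OF finE E] by fastforce
  qed
  also have "\<dots> = (\<Sum>K\<in>?\<K>. card K) + card ?\<K>" by (simp only: sum.distrib sum_constant) simp
  also have "(\<Sum>K\<in>?\<K>. card K) = card (\<Union> ?\<K>)"
    using K disj by (intro card_Union_disjoint[symmetric]) (auto simp: pairwise_def disjnt_def)
  also have "\<dots> \<le> card E" using K finE by (intro card_mono) auto
  finally show ?thesis by simp
qed

text \<open>Recoloring a star forest subgraph by its stars squeezes twice the color degree sum
  strictly below n (n + 1).\<close>

lemma sum_color_degree_imp_rainbow_triangle: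
  assumes "simple_graph V E"
    and sum: "card V * (card V + 1) \<le> 2 * (\<Sum>v\<in>V. color_degree E C v)"
  shows "\<exists>x y z. rainbow_triangle E C x y z"
proof (rule ccontr)
  assume no: "\<not> ?thesis"
  interpret simple_graph V E by fact
  obtain F where F: "F \<subseteq> E" "star_forest_coloring F C" "color_degree F C = color_degree E C"
    using ex_star_forest_subgraph finite_nsets_subset[OF finite_vertices edges] by metis
  then have FV: "F \<subseteq> nsets V 2" using edges by auto
  have same: "star F C f = star F C e" if "e \<in> F" "f \<in> F" "C f = C e" "f \<inter> e \<noteq> {}" for e f
    using that star_eq[OF FV F(2), of e f] by (simp add: star_def)
  have "\<not> distinct [star F C {x, y}, star F C {y, z}, star F C {x, z}]"
    if t: "triangle F x y z" for x y z
  proof -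
    have "\<not> distinct [C {x, y}, C {y, z}, C {x, z}]"
      using no t F(1) unfolding rainbow_triangle_def triangle_def by blast
    \<comment> \<open>Any two edges of a triangle meet, so two of equal color lie in the same
      star.\<close>
    then show ?thesis
      using t same[of "{x, y}" "{y, z}"] same[of "{x, y}" "{x, z}"] same[of "{y, z}" "{x, z}"]
      unfolding triangle_def by auto
  qed
  then have "2 * (card F + card (star F C ` F)) < card V * (card V + 1)"
    using edges_plus_colors_less[OF finite_vertices vertices_nonempty FV] by blast
  then show False
    using sum_color_degree_le[OF finite_vertices FV F(2)] sum F(3) by simp
qed

theorem corollary1:
  fixes V :: "'a set" and E :: "'a set set" and C :: "'a set \<Rightarrow> nat" and n :: nat
  assumes "simple_graph V E"
    and "card V = n"
    and "\<And>v. v \<in> V \<Longrightarrow> real (color_degree E C v) \<ge> (real n + 1) / 2"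
  shows "\<exists>x y z. rainbow_triangle E C x y z"
proof (rule sum_color_degree_imp_rainbow_triangle[OF assms(1)])
  have "n + 1 \<le> 2 * color_degree E C v" if "v \<in> V" for v
    using assms(3)[OF that] by (simp add: field_simps)
  then have "(\<Sum>v\<in>V. n + 1) \<le> (\<Sum>v\<in>V. 2 * color_degree E C v)" by (rule sum_mono)
  then show "card V * (card V + 1) \<le> 2 * (\<Sum>v\<in>V. color_degree E C v)"
    using assms(2) by (simp add: sum_distrib_left)
qed

end
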